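(* Let $U$ be an open subset of $\mathbb{R}^2$ and let $h:U\to\mathbb{L}^3$ be a $C^\infty$-differentiable time-like surface whose principal curvatures are real-valued. If $o\in U$ is a point such that there are no umbilics on $U\setminus\{o\}$, then there exists a $C^1$-differentiable curvature line flow on $U\setminus\{o\}$ with zero index at $o$.
   Context: $\mathbb{L}^3$ is the Lorentz-Minkowski 3-space, i.e. $\mathbb{R}^3$ with the inner product $x_1y_1+x_2y_2-x_3y_3$ (signature $(++-)$). A time-like surface is an immersion $h:U\to\mathbb{L}^3$ whose induced metric is Lorentzian; $U$ is a neighborhood of $o$ in $\mathbb{R}^2$. With $\nu$ a unit normal field ($\nu\cdot\nu=1$), the shape operator $A_h$ is defined by $d\nu=-dh\circ A_h$; its eigenvalues are the principal curvatures (in general they need not be real). An umbilic is a point where $A_h$ is a scalar multiple of the identity. A principal direction is a (real) eigen-direction of $A_h$. A curvature line flow on $U\setminus\{o\}$ is the flow (foliation) generated by a field of principal directions (1-dimensional tangent subspaces) on $U\setminus\{o\}$. It is called $C^1$-differentiable when it is generated by a continuous direction field (so that its leaves are $C^1$ curves). Its index at $o$ is the total variation of the angle of the direction along a small counterclockwise circle around $o$, divided by $2\pi$, an element of $\frac12\mathbb{Z}$. *)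

theory Defs
  imports "HOL-Analysis.Analysis"
begin

definition lorentz_inner :: "real^3 \<Rightarrow> real^3 \<Rightarrow> real" (infixl "\<bullet>\<^sub>L" 70) where
  "x \<bullet>\<^sub>L y = x $ 1 * y $ 1 + x $ 2 * y $ 2 - x $ 3 * y $ 3"

text \<open>The differential of a map at a point. It is only used at points of differentiability
  in the interior of the domain.\<close>

abbreviation differential ::
  "('a::real_normed_vector \<Rightarrow> 'b::real_normed_vector) \<Rightarrow> 'a \<Rightarrow> 'a \<Rightarrow> 'b" where
  "differential f p \<equiv> frechet_derivative f (at p)"

text \<open>\<open>k_times_differentiable_on U f k\<close>: on the open set \<open>U\<close> the map \<open>f\<close> has all iterated
  directional derivatives up to order \<open>k\<close>, and these are continuous.\<close>

primrec k_times_differentiable_on ::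
  "'a::real_normed_vector set \<Rightarrow> ('a \<Rightarrow> 'b::real_normed_vector) \<Rightarrow> nat \<Rightarrow> bool" where
  "k_times_differentiable_on U f 0 \<longleftrightarrow> continuous_on U f"
| "k_times_differentiable_on U f (Suc k) \<longleftrightarrow>
     (\<forall>p\<in>U. f differentiable (at p)) \<and>
     (\<forall>v. k_times_differentiable_on U (\<lambda>p. differential f p v) k)"

definition smooth_on :: "'a::real_normed_vector set \<Rightarrow> ('a \<Rightarrow> 'b::real_normed_vector) \<Rightarrow> bool" where
  "smooth_on U f \<longleftrightarrow> (\<forall>k. k_times_differentiable_on U f k)"

definition induced_metric :: "(real^2 \<Rightarrow> real^3) \<Rightarrow> real^2 \<Rightarrow> real^2 \<Rightarrow> real^2 \<Rightarrow> real" where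
  "induced_metric h p v w = differential h p v \<bullet>\<^sub>L differential h p w"

text \<open>A symmetric bilinear form on the plane is Lorentzian if it has signature \<open>(+-)\<close>; a pair
  as below is automatically linearly independent, hence an orthonormal basis.\<close>

definition lorentzian :: "(real^2 \<Rightarrow> real^2 \<Rightarrow> real) \<Rightarrow> bool" where
  "lorentzian g \<longleftrightarrow> (\<exists>v w. g v v = 1 \<and> g w w = -1 \<and> g v w = 0)"

definition smooth_timelike_surface :: "(real^2) set \<Rightarrow> (real^2 \<Rightarrow> real^3) \<Rightarrow> bool" where
  "smooth_timelike_surface U h \<longleftrightarrow>
     open U \<and> smooth_on U h \<and>
     (\<forall>p\<in>U. inj (differential h p) \<and> lorentzian (induced_metric h p))"

text \<open>Only differentiability of the field is required, which is what \<open>d\<nu>\<close> needs; such a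
  field on a smooth time-like surface exists (see below), is unique up to sign on each component,
  and hence is smooth.\<close>

definition unit_normal_field ::
  "(real^2) set \<Rightarrow> (real^2 \<Rightarrow> real^3) \<Rightarrow> (real^2 \<Rightarrow> real^3) \<Rightarrow> bool" where
  "unit_normal_field U h \<nu> \<longleftrightarrow>
     (\<forall>p\<in>U. \<nu> differentiable (at p) \<and> \<nu> p \<bullet>\<^sub>L \<nu> p = 1 \<and> (\<forall>v. \<nu> p \<bullet>\<^sub>L differential h p v = 0))"

definition shape_operator ::
  "(real^2 \<Rightarrow> real^3) \<Rightarrow> (real^2 \<Rightarrow> real^3) \<Rightarrow> real^2 \<Rightarrow> real^2 \<Rightarrow> real^2" where
  "shape_operator h \<nu> p =
     (THE A. linear A \<and> (\<forall>v. differential \<nu> p v = - differential h p (A v)))"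

text \<open>The principal curvatures at a point are the eigenvalues of the complexified shape operator.\<close>

definition principal_curvatures ::
  "(real^2 \<Rightarrow> real^3) \<Rightarrow> (real^2 \<Rightarrow> real^3) \<Rightarrow> real^2 \<Rightarrow> complex set" where
  "principal_curvatures h \<nu> p =
     {k. \<exists>w::complex^2. w \<noteq> 0 \<and>
           (\<chi> i j. complex_of_real (matrix (shape_operator h \<nu> p) $ i $ j)) *v w = k *s w}"

definition umbilic :: "(real^2 \<Rightarrow> real^3) \<Rightarrow> (real^2 \<Rightarrow> real^3) \<Rightarrow> real^2 \<Rightarrow> bool" where
  "umbilic h \<nu> p \<longleftrightarrow> (\<exists>c. \<forall>v. shape_operator h \<nu> p v = c *\<^sub>R v)"

definition principal_direction ::
  "(real^2 \<Rightarrow> real^3) \<Rightarrow> (real^2 \<Rightarrow> real^3) \<Rightarrow> real^2 \<Rightarrow> (real^2) set \<Rightarrow> bool" where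
  "principal_direction h \<nu> p L \<longleftrightarrow>
     (\<exists>v c. v \<noteq> 0 \<and> shape_operator h \<nu> p v = c *\<^sub>R v \<and> L = span {v})"

text \<open>Direction fields take values in the lines through the origin; such a field is continuous
  if it is locally spanned by continuous nowhere vanishing vector fields.\<close>

definition continuous_direction_field ::
  "(real^2) set \<Rightarrow> (real^2 \<Rightarrow> (real^2) set) \<Rightarrow> bool" where
  "continuous_direction_field S D \<longleftrightarrow>
     (\<forall>p\<in>S. \<exists>V \<xi>. open V \<and> p \<in> V \<and> continuous_on (V \<inter> S) \<xi> \<and>
        (\<forall>q\<in>V \<inter> S. \<xi> q \<noteq> 0 \<and> D q = span {\<xi> q}))"

text \<open>A curvature line flow is represented by the field of principal directions generating it;
  it is \<open>C\<^sup>1\<close>-differentiable when this field is continuous.\<close>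

definition C1_curvature_line_flow ::
  "(real^2) set \<Rightarrow> (real^2 \<Rightarrow> real^3) \<Rightarrow> (real^2 \<Rightarrow> real^3) \<Rightarrow> (real^2 \<Rightarrow> (real^2) set) \<Rightarrow> bool" where
  "C1_curvature_line_flow S h \<nu> D \<longleftrightarrow>
     (\<forall>p\<in>S. principal_direction h \<nu> p (D p)) \<and> continuous_direction_field S D"

text \<open>The index at \<open>a\<close> is \<open>i\<close>: along every sufficiently small circle around \<open>a\<close> there is a
  continuous angle function \<open>\<theta>\<close> of the direction whose total variation is \<open>2 \<pi> i\<close>. Angle functions
  on a given circle differ by constants in \<open>\<pi> \<int>\<close>, so the choice of \<open>\<theta>\<close> is irrelevant.\<close>

definition has_index :: "(real^2 \<Rightarrow> (real^2) set) \<Rightarrow> real^2 \<Rightarrow> real \<Rightarrow> bool" where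
  "has_index D a i \<longleftrightarrow>
     (\<forall>\<^sub>F r in at_right 0. \<exists>\<theta>::real \<Rightarrow> real.
        continuous_on {0..2*pi} \<theta> \<and>
        (\<forall>t\<in>{0..2*pi}.
           D (a + r *\<^sub>R vector [cos t, sin t]) = span {vector [cos (\<theta> t), sin (\<theta> t)]}) \<and>
        i = (\<theta> (2*pi) - \<theta> 0) / (2*pi))"

lemma smooth_differential_differentiable:
  assumes "smooth_on U f" "p \<in> U"
  shows "(\<lambda>q. differential f q v) differentiable (at p)"
proof -
  have "k_times_differentiable_on U f (Suc (Suc 0))"
    using assms(1) unfolding smooth_on_def by blast
  then show ?thesis using assms(2) by simp
qed

lemma differentiable_nth:
  fixes f :: "'a::real_normed_vector \<Rightarrow> real^'n"
  assumes "f differentiable (at p)"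
  shows "(\<lambda>q. f q $ i) differentiable (at p)"
  using assms bounded_linear.has_derivative[OF bounded_linear_vec_nth]
  unfolding differentiable_def by blast

lemma differentiable_scaleR_real:
  fixes f :: "'a::real_normed_vector \<Rightarrow> real" and c :: "'b::real_normed_vector"
  assumes "f differentiable (at p)"
  shows "(\<lambda>q. f q *\<^sub>R c) differentiable (at p)"
  using assms bounded_linear.has_derivative[OF bounded_linear_scaleR_left]
  unfolding differentiable_def by blast

lemma unit_normal_field_exists:
  assumes "smooth_timelike_surface U h"
  shows "\<exists>\<nu>. unit_normal_field U h \<nu>"
proof -
  define a where "a = (\<lambda>p. differential h p (axis 1 1))"
  define b where "b = (\<lambda>p. differential h p (axis 2 1))"
  define n1 where "n1 = (\<lambda>p. a p $ 2 * b p $ 3 - a p $ 3 * b p $ 2)"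
  define n2 where "n2 = (\<lambda>p. a p $ 3 * b p $ 1 - a p $ 1 * b p $ 3)"
  define n3 where "n3 = (\<lambda>p. - (a p $ 1 * b p $ 2 - a p $ 2 * b p $ 1))"
  define Q where "Q = (\<lambda>p. n1 p * n1 p + n2 p * n2 p - n3 p * n3 p)"
  define \<nu> :: "real^2 \<Rightarrow> real^3" where
    "\<nu> = (\<lambda>p. (n1 p / sqrt (Q p)) *\<^sub>R axis 1 1 + (n2 p / sqrt (Q p)) *\<^sub>R axis 2 1
                + (n3 p / sqrt (Q p)) *\<^sub>R axis 3 1)"
  have nu: "\<nu> p $ 1 = n1 p / sqrt (Q p)" "\<nu> p $ 2 = n2 p / sqrt (Q p)"
    "\<nu> p $ 3 = n3 p / sqrt (Q p)" for p
    by (auto simp: \<nu>_def axis_def)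
  have "\<nu> differentiable (at p) \<and> \<nu> p \<bullet>\<^sub>L \<nu> p = 1 \<and> (\<forall>v. \<nu> p \<bullet>\<^sub>L differential h p v = 0)"
    if "p \<in> U" for p
  proof -
    have sm: "smooth_on U h" and lor: "lorentzian (induced_metric h p)"
      using assms that by (auto simp: smooth_timelike_surface_def)
    have "k_times_differentiable_on U h (Suc 0)" using sm unfolding smooth_on_def by blast
    then have "h differentiable (at p)" using that by simp
    then have lin: "linear (differential h p)" by (rule linear_frechet_derivative)
    have d: "differential h p v = v $ 1 *\<^sub>R a p + v $ 2 *\<^sub>R b p" for v
    proof -
      have "v = v $ 1 *\<^sub>R axis 1 1 + v $ 2 *\<^sub>R axis 2 1"
        by (simp add: vec_eq_iff forall_2 axis_def)
      then have "differential h p v =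
          differential h p (v $ 1 *\<^sub>R axis 1 1 + v $ 2 *\<^sub>R axis 2 1)" by simp
      then show ?thesis by (simp only: linear_add[OF lin] linear_scale[OF lin] a_def b_def)
    qed
    define E where "E = a p \<bullet>\<^sub>L a p"
    define F where "F = a p \<bullet>\<^sub>L b p"
    define G where "G = b p \<bullet>\<^sub>L b p"
    have g: "induced_metric h p v w =
        v $ 1 * w $ 1 * E + (v $ 1 * w $ 2 + v $ 2 * w $ 1) * F + v $ 2 * w $ 2 * G" for v w
      unfolding induced_metric_def d E_def F_def G_def lorentz_inner_def
      by (simp add: algebra_simps)
    obtain v w where vw: "induced_metric h p v v = 1" "induced_metric h p w w = -1"
      "induced_metric h p v w = 0" using lor unfolding lorentzian_def by blast
    have "induced_metric h p v v * induced_metric h p w w - (induced_metric h p v w)\<^sup>2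
        = (v $ 1 * w $ 2 - v $ 2 * w $ 1)\<^sup>2 * (E * G - F\<^sup>2)"
      unfolding g by (simp add: algebra_simps power2_eq_square)
    then have "(v $ 1 * w $ 2 - v $ 2 * w $ 1)\<^sup>2 * (E * G - F\<^sup>2) = -1" using vw by simp
    then have neg: "E * G - F\<^sup>2 < 0"
      by (metis mult_nonneg_nonneg not_le zero_le_power2 neg_0_le_iff_le not_one_le_zero)
    have "Q p = - (E * G - F\<^sup>2)"
      unfolding Q_def n1_def n2_def n3_def E_def F_def G_def lorentz_inner_def
      by (simp add: algebra_simps power2_eq_square)
    then have Q: "Q p > 0" using neg by simp
    have "a differentiable (at p)" "b differentiable (at p)"
      unfolding a_def b_def using smooth_differential_differentiable[OF sm that] by auto
    note ab = this[THEN differentiable_nth]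
    have dn: "n1 differentiable (at p)" "n2 differentiable (at p)" "n3 differentiable (at p)"
      unfolding n1_def n2_def n3_def by (auto intro!: derivative_intros ab)
    have "Q differentiable (at p)" unfolding Q_def by (auto intro!: derivative_intros dn)
    moreover have "sqrt differentiable (at (Q p))"
      using Q by (meson DERIV_real_sqrt real_differentiable_def)
    ultimately have "(\<lambda>q. sqrt (Q q)) differentiable (at p)"
      using differentiable_chain_at[of Q p sqrt] by (simp add: o_def)
    then have "(\<lambda>q. n1 q / sqrt (Q q)) differentiable (at p)"
        "(\<lambda>q. n2 q / sqrt (Q q)) differentiable (at p)"
        "(\<lambda>q. n3 q / sqrt (Q q)) differentiable (at p)"
      using Q by (auto intro!: differentiable_divide dn)
    then have "\<nu> differentiable (at p)"
      unfolding \<nu>_def by (intro differentiable_add differentiable_scaleR_real)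
    moreover have "\<nu> p \<bullet>\<^sub>L \<nu> p = Q p / (sqrt (Q p) * sqrt (Q p))"
      unfolding lorentz_inner_def nu Q_def
      by (simp add: add_divide_distrib diff_divide_distrib)
    moreover have "\<nu> p \<bullet>\<^sub>L differential h p v = 0" for v
    proof -
      have "n1 p * x $ 1 + n2 p * x $ 2 - n3 p * x $ 3 = 0"
        if "x = v $ 1 *\<^sub>R a p + v $ 2 *\<^sub>R b p" for x
        unfolding that n1_def n2_def n3_def by (simp add: algebra_simps)
      from this[OF d] have "(n1 p * differential h p v $ 1 + n2 p * differential h p v $ 2
          - n3 p * differential h p v $ 3) / sqrt (Q p) = 0" by simp
      then show ?thesis unfolding lorentz_inner_def nu
        by (simp add: add_divide_distrib diff_divide_distrib)
    qed
    ultimately show ?thesis using Q by simp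
  qed
  then show ?thesis unfolding unit_normal_field_def by blast
qed

lemma shape_operator_well_defined:
  assumes "smooth_timelike_surface U h" "unit_normal_field U h \<nu>" "p \<in> U"
  shows "linear (shape_operator h \<nu> p)"
    and "differential \<nu> p v = - differential h p (shape_operator h \<nu> p v)"
proof -
  have "open U" and sm: "smooth_on U h" and inj: "inj (differential h p)"
    using assms by (auto simp: smooth_timelike_surface_def)
  have "k_times_differentiable_on U h (Suc 0)" using sm unfolding smooth_on_def by blast
  then have "h differentiable (at p)" using assms(3) by simp
  then have lin: "linear (differential h p)" by (rule linear_frechet_derivative)
  have nd: "\<nu> differentiable (at p)" and n1: "\<nu> p \<bullet>\<^sub>L \<nu> p = 1"
    and n0: "\<nu> p \<bullet>\<^sub>L differential h p v = 0" for v
    using assms by (auto simp: unit_normal_field_def)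
  have linn: "linear (differential \<nu> p)" using nd by (rule linear_frechet_derivative)
  have der: "(\<nu> has_derivative differential \<nu> p) (at p)"
    using nd by (simp add: frechet_derivative_works)
  note dc = bounded_linear.has_derivative[OF bounded_linear_vec_nth der]
  have "((\<lambda>q. \<nu> q \<bullet>\<^sub>L \<nu> q) has_derivative (\<lambda>v. 2 * (\<nu> p \<bullet>\<^sub>L differential \<nu> p v))) (at p)"
    unfolding lorentz_inner_def
    by (auto intro!: derivative_eq_intros dc simp: algebra_simps)
  moreover have "((\<lambda>q. \<nu> q \<bullet>\<^sub>L \<nu> q) has_derivative (\<lambda>v. 0)) (at p)"
  proof (rule has_derivative_transform_within_open[OF has_derivative_const \<open>open U\<close> \<open>p \<in> U\<close>])
    show "1 = \<nu> q \<bullet>\<^sub>L \<nu> q" if "q \<in> U" for q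
      using assms(2) that by (auto simp: unit_normal_field_def)
  qed
  ultimately have "(\<lambda>v. 2 * (\<nu> p \<bullet>\<^sub>L differential \<nu> p v)) = (\<lambda>v. 0)"
    by (rule has_derivative_unique)
  then have dn0: "\<nu> p \<bullet>\<^sub>L differential \<nu> p v = 0" for v by (metis mult_eq_0_iff zero_neq_numeral)
  define m :: "real^3" where "m = vector [\<nu> p $ 1, \<nu> p $ 2, - \<nu> p $ 3]"
  have m: "m \<bullet> x = \<nu> p \<bullet>\<^sub>L x" for x
    by (simp add: m_def lorentz_inner_def inner_vec_def sum_3)
  have "m \<noteq> 0" using n1 m[of "\<nu> p"] by auto
  have "range (differential h p) = {x. m \<bullet> x = 0}"
  proof (rule subspace_dim_equal)
    show "subspace (range (differential h p))"
      by (rule linear_subspace_image[OF lin subspace_UNIV])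
    show "subspace {x. m \<bullet> x = 0}" by (rule subspace_hyperplane)
    show "range (differential h p) \<subseteq> {x. m \<bullet> x = 0}" using n0 by (auto simp: m)
    have "dim (range (differential h p)) = dim (UNIV :: (real^2) set)"
      by (rule dim_image_eq[OF lin]) (use inj in simp)
    then show "dim {x. m \<bullet> x = 0} \<le> dim (range (differential h p))"
      using dim_hyperplane[OF \<open>m \<noteq> 0\<close>] by simp
  qed
  then have "\<exists>w. differential \<nu> p v = - differential h p w" for v
    using dn0[of v] m linear_neg[OF lin]
    by (metis (mono_tags, lifting) mem_Collect_eq rangeE minus_minus)
  then obtain A where A: "differential \<nu> p v = - differential h p (A v)" for v by metis
  have "linear A"
  proof (rule linearI)
    show "A (x + y) = A x + A y" for x y
    proof -
      have "differential h p (A (x + y)) = differential h p (A x + A y)"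
      proof -
        have "- differential h p (A (x + y)) = - (differential h p (A x) + differential h p (A y))"
          using A[of "x + y"] A[of x] A[of y] linear_add[OF linn, of x y] by simp
        then show ?thesis by (simp only: neg_equal_iff_equal linear_add[OF lin])
      qed
      then show ?thesis using inj by (simp add: inj_eq)
    qed
    show "A (r *\<^sub>R x) = r *\<^sub>R A x" for r x
    proof -
      have "differential h p (A (r *\<^sub>R x)) = differential h p (r *\<^sub>R A x)"
        using A[of "r *\<^sub>R x"] A[of x]
        by (simp add: linear_scale[OF lin] linear_scale[OF linn])
      then show ?thesis using inj by (simp add: inj_eq)
    qed
  qed
  have "\<exists>!A. linear A \<and> (\<forall>v. differential \<nu> p v = - differential h p (A v))"
  proof (rule ex1I[of _ A])
    show "linear A \<and> (\<forall>v. differential \<nu> p v = - differential h p (A v))"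
      using \<open>linear A\<close> A by blast
    show "B = A" if "linear B \<and> (\<forall>v. differential \<nu> p v = - differential h p (B v))" for B
    proof
      fix v
      have "differential h p (B v) = differential h p (A v)"
        using that A[of v] by simp
      then show "B v = A v" using inj by (simp add: inj_eq)
    qed
  qed
  from theI'[OF this] show "linear (shape_operator h \<nu> p)"
    "differential \<nu> p v = - differential h p (shape_operator h \<nu> p v)"
    unfolding shape_operator_def by blast+
qed

end

theory Submission
  imports Defs
begin

text \<open>Let \<open>A\<^sub>0\<close> be the traceless part of the shape operator, so that \<open>A\<^sub>0\<^sup>2 = r\<^sup>2\<close> with \<open>r \<ge> 0\<close> because
  the eigenvalues are real. The symmetric form that the metric associates with \<open>A\<^sub>0\<close> has
  nonnegative determinant and does not vanish away from umbilics, hence it is semidefinite with a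
  locally constant sign \<open>s\<close>. The image of \<open>s A\<^sub>0 + r\<close> is an eigenline of \<open>A\<^sub>0\<close> that depends
  continuously on the point (also where \<open>r = 0\<close>), and the semidefiniteness shows that it is never
  time-like. Near the exceptional point it therefore avoids a fixed time-like direction, so its angle
  cannot wind and its index is zero.\<close>

section \<open>Symmetry of second derivatives\<close>

lemma has_derivative_line:
  fixes f :: "'a::real_normed_vector \<Rightarrow> real"
  assumes "(f has_derivative f') (at (q + x *\<^sub>R v))"
  shows "((\<lambda>s. f (q + s *\<^sub>R v)) has_real_derivative f' v) (at x)"
proof -
  have lin: "linear f'"
    using assms has_derivative_linear by blast
  have "((\<lambda>s. q + s *\<^sub>R v) has_derivative (\<lambda>d. d *\<^sub>R v)) (at x)"
    by (auto intro!: derivative_eq_intros)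
  from has_derivative_compose[OF this assms]
  have "((\<lambda>s. f (q + s *\<^sub>R v)) has_derivative (\<lambda>d. f' (d *\<^sub>R v))) (at x)" .
  moreover have "(\<lambda>d. f' (d *\<^sub>R v)) = (*) (f' v)"
    using linear_scale[OF lin] by (auto simp: mult.commute)
  ultimately show ?thesis
    by (simp add: has_field_derivative_def)
qed

text \<open>The mean value theorem is used twice: along \<open>v\<close> for the difference of
  \<open>f\<close> across a \<open>w\<close>-segment, then along \<open>w\<close> for the derivative
  in direction \<open>v\<close>. The left side is symmetric in \<open>v\<close> and
  \<open>w\<close>, which is what Schwarz's theorem needs.\<close>

lemma second_difference_mean_value:
  fixes f :: "'a::real_normed_vector \<Rightarrow> real"
  assumes "t > 0"
    and f': "\<And>x y. x \<in> {0..t} \<Longrightarrow> y \<in> {0..t} \<Longrightarrow>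
      (f has_derivative f' (p + x *\<^sub>R v + y *\<^sub>R w)) (at (p + x *\<^sub>R v + y *\<^sub>R w))"
    and f'': "\<And>x y. x \<in> {0..t} \<Longrightarrow> y \<in> {0..t} \<Longrightarrow>
      ((\<lambda>q. f' q v) has_derivative f'' (p + x *\<^sub>R v + y *\<^sub>R w)) (at (p + x *\<^sub>R v + y *\<^sub>R w))"
  shows "\<exists>x\<in>{0<..<t}. \<exists>y\<in>{0<..<t}.
    f (p + t *\<^sub>R v + t *\<^sub>R w) - f (p + t *\<^sub>R v) - f (p + t *\<^sub>R w) + f p
      = t\<^sup>2 * f'' (p + x *\<^sub>R v + y *\<^sub>R w) w"
proof -
  define g where "g x = f (p + t *\<^sub>R w + x *\<^sub>R v) - f (p + x *\<^sub>R v)" for x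
  define g' where "g' x = f' (p + x *\<^sub>R v + t *\<^sub>R w) v - f' (p + x *\<^sub>R v) v" for x
  have "(g has_real_derivative g' x) (at x)" if "0 \<le> x" "x \<le> t" for x
    unfolding g_def g'_def
  proof (intro DERIV_diff)
    have eq: "p + x *\<^sub>R v + t *\<^sub>R w = p + t *\<^sub>R w + x *\<^sub>R v"
      by simp
    show "((\<lambda>x. f (p + t *\<^sub>R w + x *\<^sub>R v)) has_real_derivative f' (p + x *\<^sub>R v + t *\<^sub>R w) v) (at x)"
      by (rule has_derivative_line) (use f'[of x t] that \<open>t > 0\<close> in \<open>simp add: eq\<close>)
    show "((\<lambda>x. f (p + x *\<^sub>R v)) has_real_derivative f' (p + x *\<^sub>R v) v) (at x)"
      by (rule has_derivative_line) (use f'[of x 0] that \<open>t > 0\<close> in simp)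
  qed
  from MVT2[OF \<open>t > 0\<close> this] obtain x where x: "0 < x" "x < t" "g t - g 0 = t * g' x"
    by auto
  define k where "k y = f' (p + x *\<^sub>R v + y *\<^sub>R w) v" for y
  have "(k has_real_derivative f'' (p + x *\<^sub>R v + y *\<^sub>R w) w) (at y)" if "0 \<le> y" "y \<le> t" for y
    unfolding k_def by (rule has_derivative_line, rule f'') (use that x in auto)
  from MVT2[OF \<open>t > 0\<close> this] obtain y where y: "0 < y" "y < t"
    "k t - k 0 = t * f'' (p + x *\<^sub>R v + y *\<^sub>R w) w"
    by auto
  have "g t - g 0 = t\<^sup>2 * f'' (p + x *\<^sub>R v + y *\<^sub>R w) w"
    using x(3) y(3) by (simp add: g'_def k_def power2_eq_square)
  then show ?thesis
    using x y by (intro bexI[of _ x] bexI[of _ y]) (auto simp: g_def algebra_simps)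
qed

lemma isCont_tendsto_nhds: "isCont f x \<Longrightarrow> (f \<longlongrightarrow> f x) (nhds x)"
  unfolding isCont_def by (rule tendsto_at_iff_tendsto_nhds[THEN iffD1])

text \<open>At suitable points of a small parallelogram at \<open>p\<close> both mixed derivatives
  equal the same second difference divided by \<open>t\<^sup>2\<close>; continuity carries this to
  \<open>p\<close>.\<close>

lemma second_derivative_symmetric_real:
  fixes f :: "'a::real_normed_vector \<Rightarrow> real"
  assumes "open S" "p \<in> S"
    and f': "\<And>q. q \<in> S \<Longrightarrow> (f has_derivative f' q) (at q)"
    and fv: "\<And>q. q \<in> S \<Longrightarrow> ((\<lambda>q. f' q v) has_derivative fv q) (at q)"
    and fw: "\<And>q. q \<in> S \<Longrightarrow> ((\<lambda>q. f' q w) has_derivative fw q) (at q)"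
    and cv: "continuous_on S (\<lambda>q. fv q w)" and cw: "continuous_on S (\<lambda>q. fw q v)"
  shows "fv p w = fw p v"
proof (rule ccontr)
  assume ne: "fv p w \<noteq> fw p v"
  \<comment> \<open>Half the gap: one common value cannot be closer than \<open>e\<close> to both
    derivatives at \<open>p\<close>.\<close>
  define e where "e = \<bar>fv p w - fw p v\<bar> / 2"
  have e: "e > 0" using ne by (simp add: e_def)
  have "isCont (\<lambda>q. fv q w) p" "isCont (\<lambda>q. fw q v) p"
    using assms(1,2) cv cw by (auto simp: continuous_on_eq_continuous_at)
  then have "((\<lambda>q. fv q w) \<longlongrightarrow> fv p w) (nhds p)" "((\<lambda>q. fw q v) \<longlongrightarrow> fw p v) (nhds p)"
    by - (rule isCont_tendsto_nhds, assumption)+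
  then have "\<forall>\<^sub>F q in nhds p. dist (fv q w) (fv p w) < e \<and> dist (fw q v) (fw p v) < e \<and> q \<in> S"
    using e eventually_nhds_in_open[OF assms(1,2)]
    by (intro eventually_conj) (auto dest: tendstoD)
  then obtain r where r: "r > 0" "\<And>q. dist q p < r \<Longrightarrow>
      dist (fv q w) (fv p w) < e \<and> dist (fw q v) (fw p v) < e \<and> q \<in> S"
    unfolding eventually_nhds_metric by blast
  define N where "N = norm v + norm w + 1"
  have N: "N > 0" by (simp add: N_def add_nonneg_pos)
  \<comment> \<open>With this \<open>t\<close> the parallelogram fits into the ball of radius
    \<open>r\<close>; the summand 1 in \<open>N\<close> covers \<open>v = w = 0\<close>.\<close>
  define t where "t = r / (2 * N)"
  have t: "t > 0" using r(1) N by (simp add: t_def)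
  have near: "dist (p + x *\<^sub>R v + y *\<^sub>R w) p < r" if "x \<in> {0..t}" "y \<in> {0..t}" for x y
  proof -
    have "dist (p + x *\<^sub>R v + y *\<^sub>R w) p = norm (x *\<^sub>R v + y *\<^sub>R w)"
      by (simp add: dist_norm algebra_simps)
    also have "\<dots> \<le> x * norm v + y * norm w"
      using that by (intro order_trans[OF norm_triangle_ineq]) simp
    also have "\<dots> \<le> t * norm v + t * norm w"
      using that by (intro add_mono mult_right_mono) auto
    also have "\<dots> < t * N"
      using t by (simp add: N_def algebra_simps)
    also have "\<dots> = r / 2" using N by (simp add: t_def)
    also have "\<dots> < r" using r(1) by simp
    finally show ?thesis .
  qed
  have comm: "p + x *\<^sub>R w + y *\<^sub>R v = p + y *\<^sub>R v + x *\<^sub>R w" for x y by simp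
  obtain x y where xy: "x \<in> {0<..<t}" "y \<in> {0<..<t}"
    "f (p + t *\<^sub>R v + t *\<^sub>R w) - f (p + t *\<^sub>R v) - f (p + t *\<^sub>R w) + f p
      = t\<^sup>2 * fv (p + x *\<^sub>R v + y *\<^sub>R w) w"
    using second_difference_mean_value[OF t, of f f' p v w fv] f' fv r(2) near by blast
  obtain x' y' where xy': "x' \<in> {0<..<t}" "y' \<in> {0<..<t}"
    "f (p + t *\<^sub>R w + t *\<^sub>R v) - f (p + t *\<^sub>R w) - f (p + t *\<^sub>R v) + f p
      = t\<^sup>2 * fw (p + x' *\<^sub>R w + y' *\<^sub>R v) v"
    using second_difference_mean_value[OF t, of f f' p w v fw] f' fw r(2) near
    unfolding comm by blast
  have "t\<^sup>2 * fv (p + x *\<^sub>R v + y *\<^sub>R w) w = t\<^sup>2 * fw (p + y' *\<^sub>R v + x' *\<^sub>R w) v"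
    using xy(3) xy'(3) unfolding comm by linarith
  then have "fv (p + x *\<^sub>R v + y *\<^sub>R w) w = fw (p + y' *\<^sub>R v + x' *\<^sub>R w) v"
    using t by simp
  moreover have "dist (fv (p + x *\<^sub>R v + y *\<^sub>R w) w) (fv p w) < e"
    using r(2)[OF near[of x y]] xy by auto
  moreover have "dist (fw (p + y' *\<^sub>R v + x' *\<^sub>R w) v) (fw p v) < e"
    using r(2)[OF near[of y' x']] xy' by auto
  ultimately show False
    unfolding e_def dist_real_def by argo
qed

lemma second_derivative_symmetric:
  fixes f :: "'a::real_normed_vector \<Rightarrow> 'b::real_inner"
  assumes "open S" "p \<in> S"
    and f': "\<And>q. q \<in> S \<Longrightarrow> (f has_derivative f' q) (at q)"
    and fv: "\<And>q. q \<in> S \<Longrightarrow> ((\<lambda>q. f' q v) has_derivative fv q) (at q)"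
    and fw: "\<And>q. q \<in> S \<Longrightarrow> ((\<lambda>q. f' q w) has_derivative fw q) (at q)"
    and cv: "continuous_on S (\<lambda>q. fv q w)" and cw: "continuous_on S (\<lambda>q. fw q v)"
  shows "fv p w = fw p v"
proof -
  have "fv p w \<bullet> c = fw p v \<bullet> c" for c
    by (rule second_derivative_symmetric_real[OF assms(1,2), of "\<lambda>q. f q \<bullet> c" "\<lambda>q v. f' q v \<bullet> c" v
          "\<lambda>q v. fv q v \<bullet> c" w "\<lambda>q v. fw q v \<bullet> c"])
      (auto intro!: has_derivative_inner_left f' fv fw continuous_on_inner cv cw)
  then show ?thesis
    by (metis vector_eq_rdot)
qed

section \<open>The shape operator\<close>

lemma smooth_on_differentials:
  assumes "smooth_on U h"
  shows "\<And>p. p \<in> U \<Longrightarrow> (h has_derivative differential h p) (at p)"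
    and "\<And>p. p \<in> U \<Longrightarrow> ((\<lambda>q. differential h q v) has_derivative
      differential (\<lambda>q. differential h q v) p) (at p)"
    and "continuous_on U (\<lambda>p. differential h p v)"
    and "continuous_on U (\<lambda>p. differential (\<lambda>q. differential h q v) p w)"
proof -
  have "k_times_differentiable_on U h (Suc (Suc 0))" "k_times_differentiable_on U h (Suc 0)"
    using assms unfolding smooth_on_def by blast+
  then show "\<And>p. p \<in> U \<Longrightarrow> (h has_derivative differential h p) (at p)"
    "\<And>p. p \<in> U \<Longrightarrow> ((\<lambda>q. differential h q v) has_derivative
      differential (\<lambda>q. differential h q v) p) (at p)"
    "continuous_on U (\<lambda>p. differential h p v)"
    "continuous_on U (\<lambda>p. differential (\<lambda>q. differential h q v) p w)"
    by (auto simp flip: frechet_derivative_works)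
qed

lemma continuous_on_lorentz_inner [continuous_intros]:
  "continuous_on S f \<Longrightarrow> continuous_on S g \<Longrightarrow> continuous_on S (\<lambda>p. f p \<bullet>\<^sub>L g p)"
  unfolding lorentz_inner_def by (intro continuous_intros)

lemma lorentz_inner_commute: "x \<bullet>\<^sub>L y = y \<bullet>\<^sub>L x"
  by (simp add: lorentz_inner_def mult.commute)

lemma has_derivative_lorentz_inner:
  assumes "(f has_derivative f') (at p)" "(g has_derivative g') (at p)"
  shows "((\<lambda>q. f q \<bullet>\<^sub>L g q) has_derivative (\<lambda>v. f' v \<bullet>\<^sub>L g p + f p \<bullet>\<^sub>L g' v)) (at p)"
proof -
  note df = bounded_linear.has_derivative[OF bounded_linear_vec_nth assms(1)]
  note dg = bounded_linear.has_derivative[OF bounded_linear_vec_nth assms(2)]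
  show ?thesis
    unfolding lorentz_inner_def
    by (auto intro!: derivative_eq_intros df dg simp: algebra_simps)
qed

section \<open>The first fundamental form\<close>

locale timelike_surface =
  fixes U :: "(real^2) set" and h \<nu> :: "real^2 \<Rightarrow> real^3"
  assumes surface: "smooth_timelike_surface U h"
    and normal: "unit_normal_field U h \<nu>"
begin

lemma open_U: "open U" and smooth_h: "smooth_on U h"
  using surface by (auto simp: smooth_timelike_surface_def)

abbreviation "first_form \<equiv> induced_metric h"
abbreviation "shape \<equiv> shape_operator h \<nu>"

definition "E p = first_form p (axis 1 1) (axis 1 1)"
definition "F p = first_form p (axis 1 1) (axis 2 1)"
definition "G p = first_form p (axis 2 1) (axis 2 1)"

lemma continuous_first_form [continuous_intros]: "continuous_on U (\<lambda>p. first_form p v w)"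
  unfolding induced_metric_def
  by (intro continuous_intros smooth_on_differentials(3)[OF smooth_h])

lemma first_form_coordinates:
  assumes "p \<in> U"
  shows "first_form p v w =
    E p * (v $ 1 * w $ 1) + F p * (v $ 1 * w $ 2 + v $ 2 * w $ 1) + G p * (v $ 2 * w $ 2)"
proof -
  have lin: "linear (differential h p)"
    using smooth_on_differentials(1)[OF smooth_h assms] has_derivative_linear by blast
  have d: "differential h p v = v $ 1 *\<^sub>R differential h p (axis 1 1) + v $ 2 *\<^sub>R differential h p (axis 2 1)" for v
  proof -
    have "v = v $ 1 *\<^sub>R axis 1 1 + v $ 2 *\<^sub>R axis 2 1"
      by (simp add: vec_eq_iff forall_2 axis_def)
    then have "differential h p v =
        differential h p (v $ 1 *\<^sub>R axis 1 1 + v $ 2 *\<^sub>R axis 2 1)" by simp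
    then show ?thesis by (simp only: linear_add[OF lin] linear_scale[OF lin])
  qed
  show ?thesis
    unfolding E_def F_def G_def induced_metric_def d[of v] d[of w]
    by (simp add: lorentz_inner_def algebra_simps)
qed

lemma first_form_commute: "first_form p v w = first_form p w v"
  by (simp add: induced_metric_def lorentz_inner_commute)

lemma timelike_vector_exists:
  assumes "p \<in> U" shows "\<exists>u. first_form p u u < 0"
proof -
  have "lorentzian (first_form p)"
    using surface assms by (auto simp: smooth_timelike_surface_def)
  then obtain u where "first_form p u u = -1"
    unfolding lorentzian_def by blast
  then show ?thesis by (intro exI[of _ u]) simp
qed

text \<open>A change of basis multiplies the Gram determinant by the square of its own determinant,
  and a pair witnessing \<open>lorentzian\<close> has Gram determinant -1.\<close>

lemma first_form_det_neg:
  assumes "p \<in> U" shows "E p * G p - (F p)\<^sup>2 < 0"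
proof -
  have "lorentzian (first_form p)"
    using surface assms by (auto simp: smooth_timelike_surface_def)
  then obtain v w where vw: "first_form p v v = 1" "first_form p w w = -1" "first_form p v w = 0"
    unfolding lorentzian_def by blast
  have "first_form p v v * first_form p w w - (first_form p v w)\<^sup>2
      = (v $ 1 * w $ 2 - v $ 2 * w $ 1)\<^sup>2 * (E p * G p - (F p)\<^sup>2)"
    unfolding first_form_coordinates[OF assms] by (simp add: algebra_simps power2_eq_square)
  then have "(v $ 1 * w $ 2 - v $ 2 * w $ 1)\<^sup>2 * (E p * G p - (F p)\<^sup>2) = -1" using vw by simp
  then show ?thesis
    by (metis mult_nonneg_nonneg not_le zero_le_power2 neg_0_le_iff_le not_one_le_zero)
qed

section \<open>Self-adjointness and continuity of the shape operator\<close>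

lemma shape_linear: "p \<in> U \<Longrightarrow> linear (shape p)"
  using shape_operator_well_defined(1)[OF surface normal] .

text \<open>Differentiating the orthogonality of \<open>\<nu>\<close> and
  \<open>differential h q w\<close> moves the derivative from \<open>\<nu>\<close> to
  \<open>h\<close>. Both sides are the second fundamental form.\<close>

lemma first_form_shape:
  assumes "p \<in> U"
  shows "first_form p (shape p v) w = \<nu> p \<bullet>\<^sub>L differential (\<lambda>q. differential h q w) p v"
proof -
  have "\<nu> differentiable (at p)"
    using normal assms by (auto simp: unit_normal_field_def)
  then have d\<nu>: "(\<nu> has_derivative differential \<nu> p) (at p)"
    by (simp add: frechet_derivative_works)
  have "((\<lambda>q. \<nu> q \<bullet>\<^sub>L differential h q w) has_derivative (\<lambda>v. 0)) (at p)"
    by (rule has_derivative_transform_within_open[OF has_derivative_const open_U assms])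
      (use normal in \<open>simp add: unit_normal_field_def\<close>)
  from has_derivative_unique[OF this
      has_derivative_lorentz_inner[OF d\<nu> smooth_on_differentials(2)[OF smooth_h assms]]]
  have "differential \<nu> p v \<bullet>\<^sub>L differential h p w
    + \<nu> p \<bullet>\<^sub>L differential (\<lambda>q. differential h q w) p v = 0"
    by metis
  then show ?thesis
    using shape_operator_well_defined(2)[OF surface normal assms, of v]
    by (simp add: induced_metric_def lorentz_inner_def)
qed

lemma shape_self_adjoint:
  assumes "p \<in> U"
  shows "first_form p (shape p v) w = first_form p v (shape p w)"
proof -
  have "differential (\<lambda>q. differential h q w) p v = differential (\<lambda>q. differential h q v) p w"
    using smooth_on_differentials[OF smooth_h]
    by (intro second_derivative_symmetric[OF open_U assms]) auto
  then show ?thesis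
    using first_form_shape[OF assms] first_form_commute by metis
qed

text \<open>\<open>\<nu>\<close> is only given as differentiable, so its derivative is avoided: the
  second fundamental form needs just \<open>\<nu>\<close> itself and second derivatives of
  \<open>h\<close>.\<close>

lemma continuous_first_form_shape: "continuous_on U (\<lambda>p. first_form p (shape p v) w)"
proof -
  have "continuous_on U \<nu>"
    using normal unfolding unit_normal_field_def
    by (auto intro!: differentiable_imp_continuous_on differentiable_at_imp_differentiable_on)
  then have "continuous_on U (\<lambda>p. \<nu> p \<bullet>\<^sub>L differential (\<lambda>q. differential h q w) p v)"
    by (intro continuous_intros smooth_on_differentials(4)[OF smooth_h])
  then show ?thesis
    by (rule continuous_on_eq) (simp add: first_form_shape)
qed

text \<open>Cramer's rule recovers the components from the pairings with the basis vectors, because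
  the determinant of the metric does not vanish.\<close>

lemma continuous_shape_component: "continuous_on U (\<lambda>p. shape p v $ i)"
proof -
  define b where "b j p = first_form p (shape p v) (axis j 1)" for j p
  define d where "d p = E p * G p - (F p)\<^sup>2" for p
  have cont: "continuous_on U (b j)" "continuous_on U E" "continuous_on U F" "continuous_on U G" for j
    unfolding b_def E_def F_def G_def by (intro continuous_first_form_shape continuous_first_form)+
  have d: "\<forall>p\<in>U. d p \<noteq> 0" using first_form_det_neg unfolding d_def by force
  have "continuous_on U d" unfolding d_def by (intro continuous_intros cont)
  then have "continuous_on U (\<lambda>p. (G p * b 1 p - F p * b 2 p) / d p)"
    "continuous_on U (\<lambda>p. (E p * b 2 p - F p * b 1 p) / d p)"
    using d by (auto intro!: continuous_intros cont)
  moreover have "(G p * b 1 p - F p * b 2 p) / d p = shape p v $ 1"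
    "(E p * b 2 p - F p * b 1 p) / d p = shape p v $ 2" if "p \<in> U" for p
  proof -
    have b: "b 1 p = E p * shape p v $ 1 + F p * shape p v $ 2"
      "b 2 p = F p * shape p v $ 1 + G p * shape p v $ 2"
      unfolding b_def first_form_coordinates[OF that] by (simp_all add: axis_def)
    have "d p \<noteq> 0" using d that by blast
    then show "(G p * b 1 p - F p * b 2 p) / d p = shape p v $ 1"
      "(E p * b 2 p - F p * b 1 p) / d p = shape p v $ 2"
      unfolding b by (auto simp: divide_eq_eq d_def algebra_simps power2_eq_square)
  qed
  ultimately have "continuous_on U (\<lambda>p. shape p v $ 1)" "continuous_on U (\<lambda>p. shape p v $ 2)"
    by (auto elim: continuous_on_eq)
  then show ?thesis using exhaust_2[of i] by auto
qed

lemma shape_matrix: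
  assumes "p \<in> U"
  shows "shape p v $ i = v $ 1 * shape p (axis 1 1) $ i + v $ 2 * shape p (axis 2 1) $ i"
proof -
  note lin = shape_linear[OF assms]
  have "v = v $ 1 *\<^sub>R axis 1 1 + v $ 2 *\<^sub>R axis 2 1"
    by (simp add: vec_eq_iff forall_2 axis_def)
  then have "shape p v = shape p (v $ 1 *\<^sub>R axis 1 1 + v $ 2 *\<^sub>R axis 2 1)" by simp
  then show ?thesis by (simp add: linear_add[OF lin] linear_scale[OF lin])
qed

end

section \<open>The index of a direction field transverse to a fixed direction\<close>

lemma span_scaleR_singleton:
  fixes v :: "'a::real_vector"
  assumes "c \<noteq> 0" shows "span {c *\<^sub>R v} = span {v}"
  using span_image_scale[of "{v}" "\<lambda>_. c"] assms by simp

lemma span_singleton_eq_scaleR: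
  fixes x y :: "'a::real_vector"
  assumes "span {x} = span {y}" "x \<noteq> 0"
  shows "\<exists>c. c \<noteq> 0 \<and> x = c *\<^sub>R y"
proof -
  have "x \<in> span {y}" using assms(1) span_base by blast
  then show ?thesis using assms(2) by (auto simp: span_singleton)
qed

text \<open>A line that never contains \<open>u\<close> has a unique angle strictly between that of
  the line through \<open>u\<close> and the same plus \<pi>. This angle is a continuous function of
  the point, so it returns to its initial value along a circle.\<close>

lemma has_index_zero_if_transverse:
  assumes D: "continuous_direction_field S D"
    and "R > 0" "ball a R - {a} \<subseteq> S"
    and u: "\<And>p. p \<in> ball a R - {a} \<Longrightarrow> u \<notin> D p"
  shows "has_index D a 0"
proof -
  define B where "B = ball a R - {a}"
  have "open B" by (simp add: B_def open_delete)
  have BS: "B \<subseteq> S" using assms(3) by (simp add: B_def)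
  obtain \<rho> \<alpha> where \<alpha>: "u $ 1 = \<rho> * cos \<alpha>" "u $ 2 = \<rho> * sin \<alpha>"
    using polar_Ex by metis
  define along where "along x = x $ 1 * cos \<alpha> + x $ 2 * sin \<alpha>" for x :: "real^2"
  define across where "across x = x $ 2 * cos \<alpha> - x $ 1 * sin \<alpha>" for x :: "real^2"
  have recompose: "x $ 1 = along x * cos \<alpha> - across x * sin \<alpha>"
    "x $ 2 = along x * sin \<alpha> + across x * cos \<alpha>" for x
    unfolding along_def across_def using sin_cos_squared_add[of \<alpha>] by algebra+
  have "\<exists>x. x \<noteq> 0 \<and> D p = span {x}" if "p \<in> B" for p
  proof -
    have "p \<in> S" using that BS by blast
    then obtain V \<xi> where "p \<in> V" "\<forall>q\<in>V \<inter> S. \<xi> q \<noteq> 0 \<and> D q = span {\<xi> q}"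
      using D unfolding continuous_direction_field_def by metis
    then show ?thesis using \<open>p \<in> S\<close> by blast
  qed
  \<comment> \<open>These spanning vectors need not vary continuously; only a scale-invariant ratio
    of their components has to.\<close>
  then obtain \<xi> where \<xi>: "\<And>p. p \<in> B \<Longrightarrow> \<xi> p \<noteq> 0" "\<And>p. p \<in> B \<Longrightarrow> D p = span {\<xi> p}"
    by metis
  have across: "across x \<noteq> 0" if "p \<in> B" "x \<noteq> 0" "D p = span {x}" for p x
  proof
    assume "across x = 0"
    then have x: "x $ 1 = along x * cos \<alpha>" "x $ 2 = along x * sin \<alpha>"
      using recompose[of x] by simp_all
    then have "along x \<noteq> 0" using that(2) by (auto simp: vec_eq_iff forall_2)
    then have "u = (\<rho> / along x) *\<^sub>R x"
      using x \<alpha> by (simp add: vec_eq_iff forall_2 divide_simps)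
    then have "u \<in> D p" using that(3) by (metis span_base span_mul singletonI)
    then show False using u that(1) unfolding B_def by blast
  qed
  \<comment> \<open>The cotangent of the angle from direction \<open>\<alpha>\<close> to the line
    \<open>D p\<close>, finite by transversality.\<close>
  define \<tau> where "\<tau> p = along (\<xi> p) / across (\<xi> p)" for p
  have "continuous_on B \<tau>"
  proof (subst continuous_on_eq_continuous_at[OF \<open>open B\<close>], intro ballI)
    fix p assume p: "p \<in> B"
    then have "p \<in> S" using BS by blast
    then obtain V \<eta> where V: "open V" "p \<in> V" "continuous_on (V \<inter> S) \<eta>"
      "\<forall>q\<in>V \<inter> S. \<eta> q \<noteq> 0 \<and> D q = span {\<eta> q}"
      using D unfolding continuous_direction_field_def by metis
    define W where "W = V \<inter> B"
    have W: "open W" "p \<in> W" "W \<subseteq> V \<inter> S" "W \<subseteq> B"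
      using V(1,2) p \<open>open B\<close> BS by (auto simp: W_def)
    have c: "continuous_on W \<eta>" using V(3) W(3) continuous_on_subset by blast
    have "\<forall>q\<in>W. across (\<eta> q) \<noteq> 0" using across V(4) W by blast
    then have "continuous_on W (\<lambda>q. along (\<eta> q) / across (\<eta> q))"
      unfolding along_def across_def by (intro continuous_intros c)
    then have "continuous_on W \<tau>"
    proof (rule continuous_on_eq)
      fix q assume q: "q \<in> W"
      then obtain k where k: "k \<noteq> 0" "\<eta> q = k *\<^sub>R \<xi> q"
        using span_singleton_eq_scaleR[of "\<eta> q" "\<xi> q"] \<xi>(2) V(4) W by blast
      have "along (\<eta> q) = k * along (\<xi> q)" "across (\<eta> q) = k * across (\<xi> q)"
        using k unfolding along_def across_def by (simp_all add: algebra_simps)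
      then show "along (\<eta> q) / across (\<eta> q) = \<tau> q" using k by (simp add: \<tau>_def)
    qed
    then show "isCont \<tau> p" using W continuous_on_eq_continuous_at by blast
  qed
  \<comment> \<open>The bracket is the inverse cotangent with values strictly between 0 and \<pi>,
    so no branch has to be chosen.\<close>
  define \<phi> where "\<phi> p = \<alpha> + (pi / 2 - arctan (\<tau> p))" for p
  have D\<phi>: "D p = span {vector [cos (\<phi> p), sin (\<phi> p)]}" if p: "p \<in> B" for p
  proof -
    define N where "N = sqrt (1 + (\<tau> p)\<^sup>2)"
    have N: "N > 0" by (simp add: N_def add_pos_nonneg)
    have "cos (pi / 2 - arctan (\<tau> p)) = \<tau> p / N" "sin (pi / 2 - arctan (\<tau> p)) = 1 / N"
      by (simp_all add: cos_diff sin_diff sin_arctan cos_arctan N_def)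
    then have cs: "N * cos (\<phi> p) = \<tau> p * cos \<alpha> - sin \<alpha>"
      "N * sin (\<phi> p) = \<tau> p * sin \<alpha> + cos \<alpha>"
      using N unfolding \<phi>_def cos_add[of \<alpha>] sin_add[of \<alpha>]
      by (simp_all add: right_diff_distrib distrib_left)
    have "across (\<xi> p) \<noteq> 0" using across \<xi> p by blast
    then have "along (\<xi> p) = across (\<xi> p) * \<tau> p" by (simp add: \<tau>_def)
    then have "\<xi> p = (across (\<xi> p) * N) *\<^sub>R vector [cos (\<phi> p), sin (\<phi> p)]"
      using recompose[of "\<xi> p"]
      by (simp add: vec_eq_iff forall_2 mult.assoc cs right_diff_distrib distrib_left)
    then show ?thesis
      using span_scaleR_singleton[of "across (\<xi> p) * N"] N \<open>across (\<xi> p) \<noteq> 0\<close> \<xi>(2)[OF p]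
      by (metis less_irrefl mult_eq_0_iff)
  qed
  have "continuous_on B \<phi>" unfolding \<phi>_def by (intro continuous_intros \<open>continuous_on B \<tau>\<close>)
  define circ where "circ r t = a + r *\<^sub>R (vector [cos t, sin t] :: real^2)" for r t
  have circ: "continuous_on {0..2*pi} (circ r)" "circ r ` {0..2*pi} \<subseteq> B"
    "circ r (2 * pi) = circ r 0" if "0 < r" "r < R" for r
  proof -
    have n: "norm (vector [cos t, sin t] :: real^2) = 1" for t
      by (simp add: norm_vec_def L2_set_def sum_2)
    have v: "vector [cos t, sin t] = cos t *\<^sub>R axis 1 1 + sin t *\<^sub>R (axis 2 1 :: real^2)" for t
      by (simp add: vec_eq_iff forall_2 axis_def)
    show "continuous_on {0..2*pi} (circ r)" unfolding circ_def v by (intro continuous_intros)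
    show "circ r ` {0..2*pi} \<subseteq> B"
    proof (intro image_subsetI)
      fix t
      have "dist a (circ r t) = r" using that n[of t] by (simp add: circ_def dist_norm)
      then show "circ r t \<in> B" using that by (auto simp: B_def)
    qed
    show "circ r (2 * pi) = circ r 0" by (simp add: circ_def)
  qed
  show ?thesis
    unfolding has_index_def
  proof (rule eventually_at_rightI[of 0 R])
    show "0 < R" by fact
    fix r assume "r \<in> {0<..<R}"
    then have r: "0 < r" "r < R" by auto
    show "\<exists>\<theta>::real \<Rightarrow> real. continuous_on {0..2*pi} \<theta> \<and>
        (\<forall>t\<in>{0..2*pi}.
           D (a + r *\<^sub>R vector [cos t, sin t]) = span {vector [cos (\<theta> t), sin (\<theta> t)]}) \<and>
        0 = (\<theta> (2*pi) - \<theta> 0) / (2*pi)"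
    proof (intro exI[of _ "\<lambda>t. \<phi> (circ r t)"] conjI ballI)
      show "continuous_on {0..2*pi} (\<lambda>t. \<phi> (circ r t))"
        by (rule continuous_on_compose2[OF \<open>continuous_on B \<phi>\<close> circ(1,2)[OF r]])
      show "D (a + r *\<^sub>R vector [cos t, sin t])
          = span {vector [cos (\<phi> (circ r t)), sin (\<phi> (circ r t))]}" if "t \<in> {0..2*pi}" for t
        using D\<phi>[of "circ r t"] circ(2)[OF r] that unfolding circ_def by blast
      \<comment> \<open>The angle depends on the point alone, and the circle closes up.\<close>
      show "0 = (\<phi> (circ r (2*pi)) - \<phi> (circ r 0)) / (2*pi)" using circ(3)[OF r] by simp
    qed
  qed
qed

section \<open>The linear algebra of a self-adjoint operator with real eigenvalues\<close>

text \<open>The expression is the discriminant of the characteristic polynomial; if it were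
  negative, an explicit non-real eigenvalue \<open>k\<close> would exist.\<close>

lemma discriminant_nonneg_if_real_eigenvalues:
  fixes M :: "real^2^2"
  assumes "{k. \<exists>w::complex^2. w \<noteq> 0 \<and> (\<chi> i j. complex_of_real (M $ i $ j)) *v w = k *s w} \<subseteq> \<real>"
  shows "(M $ 1 $ 1 - M $ 2 $ 2)\<^sup>2 + 4 * M $ 1 $ 2 * M $ 2 $ 1 \<ge> 0"
proof (rule ccontr)
  define d where "d = (M $ 1 $ 1 - M $ 2 $ 2)\<^sup>2 + 4 * M $ 1 $ 2 * M $ 2 $ 1"
  assume "\<not> (M $ 1 $ 1 - M $ 2 $ 2)\<^sup>2 + 4 * M $ 1 $ 2 * M $ 2 $ 1 \<ge> 0"
  then have d: "d < 0" by (simp add: d_def)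
  then have M12: "M $ 1 $ 2 \<noteq> 0" unfolding d_def by auto
  define k where "k = Complex ((M $ 1 $ 1 + M $ 2 $ 2) / 2) (sqrt (- d) / 2)"
  \<comment> \<open>Chosen to solve the first row of the eigenvalue equation; the second row is then
    the characteristic equation \<open>char\<close>.\<close>
  define w :: "complex^2" where "w = vector [M $ 1 $ 2, k - M $ 1 $ 1]"
  have "sqrt (- d) * sqrt (- d) = - d" using d by simp
  then have char: "M $ 2 $ 1 * M $ 1 $ 2 + M $ 2 $ 2 * (k - M $ 1 $ 1) = k * (k - M $ 1 $ 1)"
    by (simp add: complex_eq_iff k_def d_def field_simps power2_eq_square)
  have "w \<noteq> 0" using M12 by (auto simp: w_def vec_eq_iff forall_2)
  moreover have "(\<chi> i j. complex_of_real (M $ i $ j)) *v w = k *s w"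
    using char
    by (simp add: vec_eq_iff forall_2 matrix_vector_mult_def sum_2 w_def algebra_simps)
  ultimately have "k \<in> \<real>" using assms by blast
  then show False using d by (simp add: k_def complex_is_Real_iff)
qed

text \<open>By Cayley-Hamilton, trace times a symmetric matrix is its square plus determinant times
  identity. Hence trace times the form is a sum of nonnegative terms.\<close>

lemma psd_quadratic_form:
  fixes a b c x y :: real
  assumes "a + c > 0" "a * c - b\<^sup>2 \<ge> 0"
  shows "a * x\<^sup>2 + 2 * b * x * y + c * y\<^sup>2 \<ge> 0"
proof -
  have "(a + c) * (a * x\<^sup>2 + 2 * b * x * y + c * y\<^sup>2)
    = (a * x + b * y)\<^sup>2 + (b * x + c * y)\<^sup>2 + (a * c - b\<^sup>2) * (x\<^sup>2 + y\<^sup>2)"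
    by (simp add: power2_eq_square algebra_simps)
  also have "\<dots> \<ge> 0" using assms(2) by (intro add_nonneg_nonneg mult_nonneg_nonneg) auto
  finally show ?thesis using assms(1) by (simp add: zero_le_mult_iff)
qed

text \<open>Here \<open>(x, y; z, -x)\<close> is the traceless part of the operator and \<open>\<tau>\<close> is the Euclidean trace
  of the symmetric form that the metric \<open>(E, F; F, G)\<close> associates with it. Since that form has
  determinant \<open>-(E G - F\<^sup>2) (x\<^sup>2 + y z) \<ge> 0\<close>, it is semidefinite, with sign \<open>sgn \<tau>\<close>.\<close>

locale lorentz_self_adjoint =
  fixes E F G x y z :: real
  assumes det: "E * G - F\<^sup>2 < 0"
    and sym: "E * y - F * x = F * x + G * z"
    and disc: "x\<^sup>2 + y * z \<ge> 0"
    and nonzero: "x \<noteq> 0 \<or> y \<noteq> 0 \<or> z \<noteq> 0"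
begin

definition "\<tau> = (E * x + F * z) + (F * y - G * x)"

text \<open>Multiplicativity of the determinant for the metric matrix times the traceless operator;
  \<open>sym\<close> identifies the two off-diagonal entries of the product.\<close>

lemma det_form: "(E * x + F * z) * (F * y - G * x) - (F * x + G * z)\<^sup>2
    = - (E * G - F\<^sup>2) * (x\<^sup>2 + y * z)"
  using sym by algebra

text \<open>A symmetric form with zero trace and nonnegative determinant vanishes; as the metric is
  nondegenerate, the operator would vanish too.\<close>

lemma trace_nonzero: "\<tau> \<noteq> 0"
proof
  assume "\<tau> = 0"
  then have "F * y - G * x = - (E * x + F * z)" by (simp add: \<tau>_def)
  with det_form have "(E * x + F * z)\<^sup>2 + (F * x + G * z)\<^sup>2 = (E * G - F\<^sup>2) * (x\<^sup>2 + y * z)"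
    by (simp add: power2_eq_square algebra_simps)
  also have "\<dots> \<le> 0" using det disc by (simp add: mult_nonpos_nonneg)
  finally have eqs: "E * x + F * z = 0" "F * x + G * z = 0"
    by (simp_all add: sum_power2_le_zero_iff)
  with \<open>\<tau> = 0\<close> sym have eqs': "F * y - G * x = 0" "E * y - F * x = 0" by (simp_all add: \<tau>_def)
  \<comment> \<open>The metric matrix annihilates both columns of the operator; its adjugate turns
    this into multiples of the determinant.\<close>
  have "(E * G - F\<^sup>2) * x = 0" "(E * G - F\<^sup>2) * z = 0" "(E * G - F\<^sup>2) * y = 0"
    using eqs eqs' by algebra+
  then show False using det nonzero by simp
qed

text \<open>Write \<open>A\<close> for the operator. As \<open>A\<close> squares to
  \<open>r\<^sup>2\<close> and \<open>s\<close> to 1, the product of \<open>A - s r\<close> and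
  \<open>s A + r\<close> is zero, so the columns of the latter are eigenvectors. On them the
  semidefinite form times \<open>s\<close> equals \<open>r\<close> times the metric, which settles
  the sign for \<open>r > 0\<close>.\<close>

lemma eigenvector_causal:
  fixes v1 v2 r s :: real
  assumes r: "r = sqrt (x\<^sup>2 + y * z)" and s: "s = sgn \<tau>"
    and v: "(v1, v2) = (s * x + r, s * z) \<or> (v1, v2) = (s * y, r - s * x)"
  shows "x * v1 + y * v2 = s * r * v1" "z * v1 - x * v2 = s * r * v2"
    and "E * v1\<^sup>2 + 2 * F * v1 * v2 + G * v2\<^sup>2 \<ge> 0"
proof -
  have r2: "r * r = x\<^sup>2 + y * z" and r0: "r \<ge> 0" using disc r by simp_all
  have s2: "s * s = 1" using trace_nonzero s by (auto simp: sgn_if)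
  have expand: "s * r * (s * x + r) = (s * s) * (r * x) + s * (r * r)" "s * r * (s * z) = (s * s) * (r * z)"
    "s * r * (s * y) = (s * s) * (r * y)" "s * r * (r - s * x) = s * (r * r) - (s * s) * (r * x)"
    by (simp_all add: algebra_simps)
  have "x * v1 + y * v2 = s * r * v1 \<and> z * v1 - x * v2 = s * r * v2"
    using v
  proof (elim disjE)
    assume "(v1, v2) = (s * x + r, s * z)"
    then have v: "v1 = s * x + r" "v2 = s * z" by simp_all
    show ?thesis unfolding v expand unfolding s2 r2 by (simp add: algebra_simps power2_eq_square)
  next
    assume "(v1, v2) = (s * y, r - s * x)"
    then have v: "v1 = s * y" "v2 = r - s * x" by simp_all
    show ?thesis unfolding v expand unfolding s2 r2 by (simp add: algebra_simps power2_eq_square)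
  qed
  then show eig: "x * v1 + y * v2 = s * r * v1" "z * v1 - x * v2 = s * r * v2" by simp_all
  show "E * v1\<^sup>2 + 2 * F * v1 * v2 + G * v2\<^sup>2 \<ge> 0"
  proof (cases "r = 0")
    case True
    then have "x\<^sup>2 + y * z = 0" using r2 by simp
    \<comment> \<open>For \<open>r = 0\<close> the operator is nilpotent and self-adjoint, so every
      vector in its image is null. The last bracket in each identity is the defect of
      \<open>sym\<close>.\<close>
    have "E * (s * x)\<^sup>2 + 2 * F * (s * x) * (s * z) + G * (s * z)\<^sup>2
        = (s * s) * (E * (x\<^sup>2 + y * z) - z * (E * y - F * x - (F * x + G * z)))"
      "E * (s * y)\<^sup>2 + 2 * F * (s * y) * (- (s * x)) + G * (- (s * x))\<^sup>2
        = (s * s) * (G * (x\<^sup>2 + y * z) + y * (E * y - F * x - (F * x + G * z)))"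
      by (simp_all add: algebra_simps power2_eq_square)
    then have "E * v1\<^sup>2 + 2 * F * v1 * v2 + G * v2\<^sup>2 = 0"
      using v sym True \<open>x\<^sup>2 + y * z = 0\<close> by auto
    then show ?thesis by simp
  next
    case False
    then have "r > 0" using r0 by simp
    \<comment> \<open>Multiplying the form by \<open>s\<close> makes its trace positive and keeps
      its determinant.\<close>
    have "s * (E * x + F * z) + s * (F * y - G * x) = \<bar>\<tau>\<bar>"
      unfolding s distrib_left[symmetric] \<tau>_def[symmetric] by (simp add: sgn_if)
    then have tr: "s * (E * x + F * z) + s * (F * y - G * x) > 0" using trace_nonzero by simp
    have "s * (E * x + F * z) * (s * (F * y - G * x)) - (s * (F * x + G * z))\<^sup>2
        = (s * s) * ((E * x + F * z) * (F * y - G * x) - (F * x + G * z)\<^sup>2)"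
      by (simp add: algebra_simps power2_eq_square)
    also have "\<dots> = - (E * G - F\<^sup>2) * (x\<^sup>2 + y * z)"
      unfolding s2 det_form by simp
    finally have "s * (E * x + F * z) * (s * (F * y - G * x)) - (s * (F * x + G * z))\<^sup>2
        = - (E * G - F\<^sup>2) * (x\<^sup>2 + y * z)" .
    then have "s * (E * x + F * z) * (s * (F * y - G * x)) - (s * (F * x + G * z))\<^sup>2 \<ge> 0"
      using det disc by (simp add: mult_nonneg_nonneg mult_nonpos_nonneg)
    from psd_quadratic_form[OF tr this, of v1 v2]
    have "s * (E * x + F * z) * v1\<^sup>2 + 2 * (s * (F * x + G * z)) * v1 * v2
      + s * (F * y - G * x) * v2\<^sup>2 \<ge> 0" .
    \<comment> \<open>The form at \<open>v\<close> becomes the metric pairing of \<open>v\<close>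
      with its image, corrected by the defect of \<open>sym\<close>, so that the eigenvalue
      equations can be inserted.\<close>
    also have "s * (E * x + F * z) * v1\<^sup>2 + 2 * (s * (F * x + G * z)) * v1 * v2
        + s * (F * y - G * x) * v2\<^sup>2
      = s * ((E * v1 + F * v2) * (x * v1 + y * v2) + (F * v1 + G * v2) * (z * v1 - x * v2)
        - v1 * v2 * (E * y - F * x - (F * x + G * z)))"
      by (simp add: algebra_simps power2_eq_square)
    also have "\<dots> = (s * s) * (r * (E * v1\<^sup>2 + 2 * F * v1 * v2 + G * v2\<^sup>2))"
      unfolding eig sym by (simp add: algebra_simps power2_eq_square)
    also have "\<dots> = r * (E * v1\<^sup>2 + 2 * F * v1 * v2 + G * v2\<^sup>2)" unfolding s2 by simp
    finally show ?thesis using \<open>r > 0\<close> by (simp add: zero_le_mult_iff)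
  qed
qed

end

section \<open>The curvature line flow\<close>

locale umbilic_free_timelike_surface = timelike_surface +
  fixes a :: "real^2"
  assumes real_curvatures: "\<forall>p\<in>U. principal_curvatures h \<nu> p \<subseteq> \<real>"
    and no_umbilics: "\<forall>p\<in>U - {a}. \<not> umbilic h \<nu> p"
begin

text \<open>The shape operator is split into \<open>m\<close>, the mean curvature, times the
  identity and the traceless matrix with rows \<open>x, y\<close> and \<open>z, -x\<close>.\<close>

definition "x p = (shape p (axis 1 1) $ 1 - shape p (axis 2 1) $ 2) / 2"
definition "y p = shape p (axis 2 1) $ 1"
definition "z p = shape p (axis 1 1) $ 2"
definition "m p = (shape p (axis 1 1) $ 1 + shape p (axis 2 1) $ 2) / 2"

lemma shape_components:
  assumes "p \<in> U"
  shows "shape p v $ 1 = m p * v $ 1 + (x p * v $ 1 + y p * v $ 2)"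
    and "shape p v $ 2 = m p * v $ 2 + (z p * v $ 1 - x p * v $ 2)"
  unfolding shape_matrix[OF assms, of v] x_def y_def z_def m_def by (simp_all add: field_simps)

lemma traceless_part:
  assumes p: "p \<in> U - {a}"
  shows "lorentz_self_adjoint (E p) (F p) (G p) (x p) (y p) (z p)"
proof
  have pU: "p \<in> U" using p by simp
  show "E p * G p - (F p)\<^sup>2 < 0" using first_form_det_neg[OF pU] .
  show "E p * y p - F p * x p = F p * x p + G p * z p"
    using shape_self_adjoint[OF pU, of "axis 1 1" "axis 2 1"]
    unfolding first_form_coordinates[OF pU] shape_components[OF pU]
    by (simp add: axis_def algebra_simps)
  have "(matrix (shape p) $ 1 $ 1 - matrix (shape p) $ 2 $ 2)\<^sup>2
      + 4 * matrix (shape p) $ 1 $ 2 * matrix (shape p) $ 2 $ 1 \<ge> 0"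
    by (rule discriminant_nonneg_if_real_eigenvalues)
      (use real_curvatures pU in \<open>simp add: principal_curvatures_def\<close>)
  \<comment> \<open>The diagonal entries differ by \<open>2 * x p\<close>, so the discriminant is
    four times this quantity.\<close>
  then show "(x p)\<^sup>2 + y p * z p \<ge> 0"
    by (simp add: matrix_def x_def y_def z_def power_divide)
  show "x p \<noteq> 0 \<or> y p \<noteq> 0 \<or> z p \<noteq> 0"
  proof (rule ccontr)
    assume "\<not> ?thesis"
    then have "shape p v = m p *\<^sub>R v" for v
      using shape_components[OF pU, of v] by (simp add: vec_eq_iff forall_2)
    then show False using no_umbilics p unfolding umbilic_def by blast
  qed
qed

text \<open>The principal curvatures are \<open>m + r\<close> and \<open>m - r\<close>; the sign
  \<open>s\<close> selects the one, \<open>m + s r\<close>, whose direction the flow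
  follows.\<close>

definition "r p = sqrt ((x p)\<^sup>2 + y p * z p)"
definition "s p = sgn (lorentz_self_adjoint.\<tau> (E p) (F p) (G p) (x p) (y p) (z p))"

text \<open>The columns of \<open>s A\<^sub>0 + r\<close>, where \<open>A\<^sub>0 = (x, y; z, -x)\<close> satisfies \<open>A\<^sub>0\<^sup>2 = r\<^sup>2\<close>: both lie in the
  eigenspace of \<open>A\<^sub>0\<close> for \<open>s r\<close>, and they do not vanish simultaneously.\<close>

definition \<xi> :: "2 \<Rightarrow> real^2 \<Rightarrow> real^2" where
  "\<xi> i p = (if i = 1 then vector [s p * x p + r p, s p * z p]
            else vector [s p * y p, r p - s p * x p])"

definition D :: "real^2 \<Rightarrow> (real^2) set" where
  "D p = span {if \<xi> 1 p \<noteq> 0 then \<xi> 1 p else \<xi> 2 p}"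

lemma sign_square: "p \<in> U - {a} \<Longrightarrow> s p * s p = 1"
  using lorentz_self_adjoint.trace_nonzero[OF traceless_part] by (auto simp: s_def sgn_if)

lemma r_square: "p \<in> U - {a} \<Longrightarrow> r p * r p = (x p)\<^sup>2 + y p * z p"
  using lorentz_self_adjoint.disc[OF traceless_part] by (simp add: r_def)

text \<open>Otherwise the traceless part would be a multiple of the identity, hence zero.\<close>

lemma xi_not_both_zero:
  assumes "p \<in> U - {a}" shows "\<xi> 1 p \<noteq> 0 \<or> \<xi> 2 p \<noteq> 0"
proof (rule ccontr)
  assume "\<not> ?thesis"
  then have "s p * x p + r p = 0" "s p * z p = 0" "s p * y p = 0" "r p - s p * x p = 0"
    by (auto simp: \<xi>_def vec_eq_iff forall_2)
  moreover have "s p \<noteq> 0" using sign_square[OF assms] by auto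
  ultimately have "x p = 0" "y p = 0" "z p = 0" by auto
  then show False using lorentz_self_adjoint.nonzero[OF traceless_part[OF assms]] by blast
qed

text \<open>The matrix \<open>s A\<^sub>0 + r\<close> is singular, so nonzero columns span the same
  line. Near each point a column that does not vanish there can thus serve as spanning
  field.\<close>

lemma D_eq_span_xi:
  assumes p: "p \<in> U - {a}" and ne: "\<xi> i p \<noteq> 0"
  shows "D p = span {\<xi> i p}"
proof (cases "\<xi> 1 p \<noteq> 0 \<and> i = 2")
  case True
  have eq: "(s p * x p + r p) * (r p - s p * x p) = s p * z p * (s p * y p)"
    using sign_square[OF p] r_square[OF p] by algebra
  have ne: "\<xi> 1 p \<noteq> 0" "\<xi> 2 p \<noteq> 0" using True ne by auto
  \<comment> \<open>\<open>c\<close> is the ratio of the first components, or of the second ones if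
    the first component of \<open>\<xi> 2 p\<close> is zero; \<open>eq\<close> handles the remaining
    component.\<close>
  have "\<exists>c. \<xi> 1 p = c *\<^sub>R \<xi> 2 p"
  proof (cases "s p * y p = 0")
    case False
    then show ?thesis using eq
      by (intro exI[of _ "(s p * x p + r p) / (s p * y p)"])
        (simp add: \<xi>_def vec_eq_iff forall_2 field_simps)
  next
    case True
    then have "r p - s p * x p \<noteq> 0" using ne by (auto simp: \<xi>_def vec_eq_iff forall_2)
    then show ?thesis using eq True
      by (intro exI[of _ "(s p * z p) / (r p - s p * x p)"])
        (auto simp: \<xi>_def vec_eq_iff forall_2 field_simps)
  qed
  then obtain c where c: "\<xi> 1 p = c *\<^sub>R \<xi> 2 p" by blast
  then have "c \<noteq> 0" using ne by auto
  then show ?thesis using ne True c span_scaleR_singleton[of c "\<xi> 2 p"] by (simp add: D_def)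
next
  case False
  then show ?thesis using ne exhaust_2[of i] by (auto simp: D_def)
qed

lemma D_spanned:
  assumes "p \<in> U - {a}"
  obtains i where "\<xi> i p \<noteq> 0" "D p = span {\<xi> i p}"
  using xi_not_both_zero[OF assms] D_eq_span_xi[OF assms] by metis

lemma xi_causal_eigenvector:
  assumes p: "p \<in> U - {a}"
  shows "shape p (\<xi> i p) = (m p + s p * r p) *\<^sub>R \<xi> i p" "first_form p (\<xi> i p) (\<xi> i p) \<ge> 0"
proof -
  have pU: "p \<in> U" using p by simp
  have "(\<xi> i p $ 1, \<xi> i p $ 2) = (s p * x p + r p, s p * z p) \<or>
      (\<xi> i p $ 1, \<xi> i p $ 2) = (s p * y p, r p - s p * x p)"
    by (simp add: \<xi>_def)
  note * = lorentz_self_adjoint.eigenvector_causal[OF traceless_part[OF p] r_def s_def this]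
  show "shape p (\<xi> i p) = (m p + s p * r p) *\<^sub>R \<xi> i p"
    using * shape_components[OF pU, of "\<xi> i p"] by (simp add: vec_eq_iff forall_2 algebra_simps)
  show "first_form p (\<xi> i p) (\<xi> i p) \<ge> 0"
    using *(3) unfolding first_form_coordinates[OF pU] by (simp add: power2_eq_square algebra_simps)
qed

text \<open>The square root is continuous also where the principal curvatures coincide, and the sign
  is continuous because the trace \<open>\<tau>\<close> is continuous without zeros.\<close>

lemma continuous_xi: "continuous_on (U - {a}) (\<xi> i)"
proof -
  have c: "continuous_on (U - {a}) E" "continuous_on (U - {a}) F" "continuous_on (U - {a}) G"
    "continuous_on (U - {a}) x" "continuous_on (U - {a}) y" "continuous_on (U - {a}) z"
    unfolding E_def F_def G_def x_def y_def z_def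
    by (intro continuous_intros continuous_on_subset[OF continuous_first_form]
        continuous_on_subset[OF continuous_shape_component]; simp)+
  have "continuous_on (U - {a})
      (\<lambda>p. lorentz_self_adjoint.\<tau> (E p) (F p) (G p) (x p) (y p) (z p))"
    by (rule continuous_on_eq[of _ "\<lambda>p. (E p * x p + F p * z p) + (F p * y p - G p * x p)"])
      (auto simp: lorentz_self_adjoint.\<tau>_def[OF traceless_part] intro!: continuous_intros c)
  then have "continuous_on (U - {a}) s"
    unfolding s_def using lorentz_self_adjoint.trace_nonzero[OF traceless_part]
    by (intro continuous_on_sgn) auto
  moreover have "continuous_on (U - {a}) r" unfolding r_def by (intro continuous_intros c)
  moreover have "vector [\<alpha>, \<beta>] = \<alpha> *\<^sub>R axis 1 1 + \<beta> *\<^sub>R (axis 2 1 :: real^2)" for \<alpha> \<beta> :: real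
    by (simp add: vec_eq_iff forall_2 axis_def)
  ultimately have "continuous_on (U - {a}) (\<lambda>p. vector [s p * x p + r p, s p * z p] :: real^2)"
    "continuous_on (U - {a}) (\<lambda>p. vector [s p * y p, r p - s p * x p] :: real^2)"
    by (simp_all only:) (intro continuous_intros c; assumption)+
  then show ?thesis unfolding \<xi>_def by (cases "i = 1") simp_all
qed

lemma D_flow: "C1_curvature_line_flow (U - {a}) h \<nu> D"
  unfolding C1_curvature_line_flow_def continuous_direction_field_def
proof (intro conjI ballI)
  fix p assume p: "p \<in> U - {a}"
  obtain i where i: "\<xi> i p \<noteq> 0" "D p = span {\<xi> i p}" using D_spanned[OF p] .
  then show "principal_direction h \<nu> p (D p)"
    using xi_causal_eigenvector(1)[OF p] unfolding principal_direction_def by blast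
  define V where "V = (U - {a}) \<inter> \<xi> i -` (- {0})"
  have "open V"
    unfolding V_def using open_U by (intro continuous_open_preimage continuous_xi) auto
  moreover have "p \<in> V" using p i by (simp add: V_def)
  moreover have "\<forall>q\<in>V \<inter> (U - {a}). \<xi> i q \<noteq> 0 \<and> D q = span {\<xi> i q}"
    using D_eq_span_xi by (auto simp: V_def)
  moreover have "continuous_on (V \<inter> (U - {a})) (\<xi> i)"
    by (rule continuous_on_subset[OF continuous_xi]) simp
  ultimately show "\<exists>V \<xi>. open V \<and> p \<in> V \<and> continuous_on (V \<inter> (U - {a})) \<xi> \<and>
      (\<forall>q\<in>V \<inter> (U - {a}). \<xi> q \<noteq> 0 \<and> D q = span {\<xi> q})"
    by (intro exI[of _ V] exI[of _ "\<xi> i"] conjI)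
qed

text \<open>A vector that is time-like at \<open>a\<close> stays time-like nearby, whereas the lines
  of \<open>D\<close> contain no time-like vector; so this vector is transverse to
  \<open>D\<close>.\<close>

lemma D_index:
  assumes "a \<in> U" shows "has_index D a 0"
proof -
  obtain u where u: "first_form a u u < 0" using timelike_vector_exists[OF assms] by blast
  have "isCont (\<lambda>p. first_form p u u) a"
    using continuous_first_form open_U assms continuous_on_eq_continuous_at by blast
  then have "((\<lambda>p. first_form p u u) \<longlongrightarrow> first_form a u u) (nhds a)"
    by - (rule isCont_tendsto_nhds, assumption)+
  then have "\<forall>\<^sub>F p in nhds a. first_form p u u < 0"
    using u by (rule order_tendstoD)
  then have "\<forall>\<^sub>F p in nhds a. first_form p u u < 0 \<and> p \<in> U"
    using eventually_nhds_in_open[OF open_U assms] by (rule eventually_conj)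
  then obtain R where R: "R > 0" "\<And>p. dist p a < R \<Longrightarrow> first_form p u u < 0 \<and> p \<in> U"
    unfolding eventually_nhds_metric by blast
  show ?thesis
  proof (rule has_index_zero_if_transverse[of "U - {a}" D R])
    show "continuous_direction_field (U - {a}) D"
      using D_flow by (simp add: C1_curvature_line_flow_def)
    show "R > 0" by fact
    show "ball a R - {a} \<subseteq> U - {a}" using R(2) by (auto simp: dist_commute)
    fix p assume "p \<in> ball a R - {a}"
    then have p: "p \<in> U - {a}" and neg: "first_form p u u < 0"
      using R(2)[of p] by (auto simp: dist_commute)
    show "u \<notin> D p"
    proof
      assume "u \<in> D p"
      moreover obtain i where "D p = span {\<xi> i p}" using D_spanned[OF p] by metis
      ultimately obtain k where k: "u = k *\<^sub>R \<xi> i p" by (auto simp: span_singleton)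
      have "p \<in> U" using p by simp
      then have "first_form p u u = k\<^sup>2 * first_form p (\<xi> i p) (\<xi> i p)"
        unfolding k by (simp add: first_form_coordinates power2_eq_square algebra_simps)
      then show False using neg xi_causal_eigenvector(2)[OF p, of i] by (simp add: mult_less_0_iff)
    qed
  qed
qed

end

theorem theoremE:
  fixes U :: "(real^2) set" and h \<nu> :: "real^2 \<Rightarrow> real^3" and a :: "real^2"
  assumes "smooth_timelike_surface U h"
    and "unit_normal_field U h \<nu>"
    and "\<forall>p\<in>U. principal_curvatures h \<nu> p \<subseteq> \<real>"
    and "a \<in> U"
    and "\<forall>p\<in>U - {a}. \<not> umbilic h \<nu> p"
  shows "\<exists>D. C1_curvature_line_flow (U - {a}) h \<nu> D \<and> has_index D a 0"
proof -
  interpret umbilic_free_timelike_surface U h \<nu> a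
    using assms by unfold_locales auto
  show ?thesis using D_flow D_index[OF assms(4)] by blast
qed

end
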